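(* Consider a three-source three-destination multiple unicast network with delays, with transfer functions $M_{ij}(\underline{\varepsilon},D)$ from source $S_i$ to destination $T_j$, such that the min-cut between $S_i$ and $T_i$ is $1$ for every $i$ and the min-cut between $S_i$ and $T_j$ is non-zero for all $i\neq j$. Let $k>1$ divide $2^m-1$, and let $\alpha\in\mathbb{F}_{2^m}$ have multiplicative order $k$. Precoding based network alignment with the transform approach and block time varying local encoding kernels is used (see context). Suppose that $$\eta(0)=\frac{M_{21}(\underline{\varepsilon},1)\,M_{32}(\underline{\varepsilon},1)\,M_{13}(\underline{\varepsilon},1)}{M_{31}(\underline{\varepsilon},1)\,M_{23}(\underline{\varepsilon},1)\,M_{12}(\underline{\varepsilon},1)}$$ is not a constant (as a rational function of the local encoding kernels $\underline{\varepsilon}$). Let $i\in\{1,2,3\}$. Then the following two statements are equivalent: (a) for all $p\in\{0,1,\dots,k-1\}$, $X_i'(p)$ can be recovered from $Y_i^{(p\oplus k)}$; (b) $X_i'(0)$ can be recovered from $Y_i^{(0\oplus k)}$.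
   Context: Network. The network is a finite directed acyclic graph with sources $S_1,S_2,S_3$ and destinations $T_1,T_2,T_3$; $T_i$ wants the message of $S_i$. Each link $e$ is error-free, carries one $\mathbb{F}_{2^m}$-symbol per use, and has a positive integer delay $d_e$. Scalar linear network coding is used. The local encoding kernels (LEKs) are the coefficients $\alpha_{i,e}$ (source $S_i$, link $e$ with tail $S_i$), $\beta_{e',e}$ (links with $\mathrm{head}(e')=\mathrm{tail}(e)$) and $\epsilon_{e',j}$ (destination $T_j$, link $e'$ with head $T_j$). Their collection is denoted $\underline{\varepsilon}$, and they are treated as independent indeterminates over $\mathbb{F}_{2^m}$. Transfer functions. For a directed path $P$ from $S_i$ to $T_j$ with consecutive links $e_1,\dots,e_r$, the path gain is $G(P)=\alpha_{i,e_1}\beta_{e_1,e_2}\cdots\beta_{e_{r-1},e_r}\epsilon_{e_r,j}$ and the path delay is $d_P=\sum_s d_{e_s}$. The transfer function is $M_{ij}(\underline{\varepsilon},D)=\sum_P G(P)D^{d_P}$, summed over all paths from $S_i$ to $T_j$ (a power of $D$ common to all pairs $(i,j)$ may be factored out). Scheme. Let $n>1$ be an integer. Transmission uses $2n+1$ time blocks, each consisting of $k$ symbols (transformed by the $k\times k$ DFT matrix built from $\alpha$) preceded by a cyclic prefix, with $k$ much larger than the delay spread of the network. The LEKs are constant within a block and are varied from block to block; $\underline{\varepsilon}_l$ denotes the LEKs in block $l$ (the $\underline{\varepsilon}_l$ are independent copies of $\underline{\varepsilon}$). For $0\le p\le k-1$ let $$M_{ij}^p=\mathrm{diag}\big(M_{ij}(\underline{\varepsilon}_1,\alpha^p),\dots,M_{ij}(\underline{\varepsilon}_{2n+1},\alpha^p)\big).$$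 The vectors $X_1'(p),X_2'(p),X_3'(p)$ of independent source symbols have lengths $n+1,n,n$. Source $S_i$ precodes $X_i'(p)$ by a matrix $V_i^{(p)}$, of size $(2n+1)\times(n+1)$ for $i=1$ and $(2n+1)\times n$ for $i=2,3$. After the prefix is discarded and the inverse DFT applied, $T_j$ has $$Y_j^{(p\oplus k)}=\sum_{i=1}^3 M_{ij}^pV_i^{(p)}X_i'(p),\qquad 0\le p\le k-1.$$ Precoding based network alignment requires, for $0\le p\le k-1$, the alignment conditions (Span is column space; $\subset$ allows equality) $$\mathrm{Span}(M_{31}^pV_3^{(p)})\subset\mathrm{Span}(M_{21}^pV_2^{(p)}),\ \ \mathrm{Span}(M_{32}^pV_3^{(p)})\subset\mathrm{Span}(M_{12}^pV_1^{(p)}),\ \ \mathrm{Span}(M_{23}^pV_2^{(p)})\subset\mathrm{Span}(M_{13}^pV_1^{(p)}),$$ and the rank conditions $$\mathrm{Rank}[M_{11}^pV_1^{(p)}\ \ M_{21}^pV_2^{(p)}]=\mathrm{Rank}[M_{22}^pV_2^{(p)}\ \ M_{12}^pV_1^{(p)}]=\mathrm{Rank}[M_{33}^pV_3^{(p)}\ \ M_{13}^pV_1^{(p)}]=2n+1$$ at $T_1,T_2,T_3$ respectively. Precoders. When $\eta(0)$ is not a constant, the precoding matrices are chosen as follows. Let $W$ be the all-ones column of length $2n+1$, $U=(M_{12}^p)^{-1}M_{32}^p(M_{31}^p)^{-1}M_{21}^p(M_{23}^p)^{-1}M_{13}^p$, $R=M_{13}^p(M_{23}^p)^{-1}$, $S=M_{12}^p(M_{32}^p)^{-1}$,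 and $$V_1^{(p)}=[W\ \ UW\ \cdots\ U^nW],\quad V_2^{(p)}=[RW\ \ RUW\ \cdots\ RU^{n-1}W],\quad V_3^{(p)}=[SUW\ \ SU^2W\ \cdots\ SU^nW].$$ With this choice the three alignment conditions hold automatically. Recovery. "$X_i'(p)$ can be recovered from $Y_i^{(p\oplus k)}$" means that, for every $n>1$, $T_i$ can determine $X_i'(p)$ from $Y_i^{(p\oplus k)}$ with this scheme, i.e. the rank condition above at $T_i$ holds (with the LEKs as indeterminates). *)

theory Defs
  imports
    "HOL-Library.Poly_Mapping"
    "HOL-Computational_Algebra.Polynomial"
    "HOL-Computational_Algebra.Fraction_Field"
    "Graph_Theory.Digraph"
    "Graph_Theory.Arc_Walk"
    "Jordan_Normal_Form.Matrix"
    "Jordan_Normal_Form.Gauss_Jordan_Elimination"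
    "Jordan_Normal_Form.DL_Rank"
begin

section \<open>Rational functions in arbitrarily many indeterminates\<close>

text \<open>
  Polynomials are finitely supported maps from monomials to coefficients. The library proves
  that they form an integral domain only for linearly ordered indeterminates. The type below wraps
  an arbitrary type and equips it with some linear order (from the well-ordering theorem), so that
  no assumption on the type of indeterminates is needed. The order has no other purpose.
\<close>

datatype 'x indet = Indet 'x

definition indet_order :: "'x indet rel" where
  "indet_order = (SOME r. well_order_on UNIV r)"

lemma well_order_indet_order: "well_order_on UNIV (indet_order :: 'x indet rel)"
  unfolding indet_order_def by (rule someI_ex) (rule well_order_on)

instantiation indet :: (type) linorder
begin

definition less_eq_indet :: "'a indet \<Rightarrow> 'a indet \<Rightarrow> bool" where
  "x \<le> y \<longleftrightarrow> (x, y) \<in> indet_order"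

definition less_indet :: "'a indet \<Rightarrow> 'a indet \<Rightarrow> bool" where
  "x < y \<longleftrightarrow> (x, y) \<in> indet_order \<and> (y, x) \<notin> indet_order"

instance
proof -
  have lin: "linear_order_on UNIV (indet_order :: 'a indet rel)"
    using well_order_indet_order unfolding well_order_on_def by blast
  have r: "refl (indet_order :: 'a indet rel)" and t: "trans (indet_order :: 'a indet rel)"
    and a: "antisym (indet_order :: 'a indet rel)" and tot: "total (indet_order :: 'a indet rel)"
    using lin unfolding linear_order_on_def partial_order_on_def preorder_on_def by auto
  show "OFCLASS('a indet, linorder_class)"
  proof
    fix x y z :: "'a indet"
    show "x < y \<longleftrightarrow> x \<le> y \<and> \<not> y \<le> x"
      by (simp add: less_eq_indet_def less_indet_def)
    show "x \<le> x"
      using r by (simp add: less_eq_indet_def refl_on_def)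
    show "x \<le> y \<Longrightarrow> y \<le> z \<Longrightarrow> x \<le> z"
      using t unfolding less_eq_indet_def by (rule transD)
    show "x \<le> y \<Longrightarrow> y \<le> x \<Longrightarrow> x = y"
      using a unfolding less_eq_indet_def by (rule antisymD)
    show "x \<le> y \<or> y \<le> x"
      using r tot unfolding less_eq_indet_def by (cases "x = y") (auto simp: refl_on_def total_on_def)
  qed
qed

end

type_synonym ('x, 'f) ratfun = "(('x indet \<Rightarrow>\<^sub>0 nat) \<Rightarrow>\<^sub>0 'f) fract"

definition rf_const :: "'f::field \<Rightarrow> ('x, 'f) ratfun" where
  "rf_const c = Fract (Poly_Mapping.single 0 c) 1"

definition rf_var :: "'x \<Rightarrow> ('x, 'f::field) ratfun" where
  "rf_var v = Fract (Poly_Mapping.single (Poly_Mapping.single (Indet v) 1) 1) 1"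

section \<open>Networks with delays and their transfer functions\<close>

text \<open>
  Names of the local encoding kernels: \<open>Alpha i e\<close>, \<open>Beta e' e\<close> and \<open>Eps e' j\<close>
  stand for $\alpha_{i,e}$, $\beta_{e',e}$ and $\epsilon_{e',j}$.
\<close>

datatype 'e lek = Alpha nat 'e | Beta 'e 'e | Eps 'e nat

text \<open>
  Links are the arcs of a finite directed multigraph; sources and destinations are indexed by
  1, 2, 3, the values of \<open>src\<close> and \<open>dst\<close> at other indices being irrelevant. Two sources
  (or two destinations) may be located at the same vertex.
\<close>

locale delay_network = fin_digraph G
  for G :: "('v, 'e) pre_digraph" +
  fixes src :: "nat \<Rightarrow> 'v"
    and dst :: "nat \<Rightarrow> 'v"
    and delay :: "'e \<Rightarrow> nat"
  assumes acyclic: "\<nexists>c. cycle c"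
    and src_in_verts: "i \<in> {1, 2, 3} \<Longrightarrow> src i \<in> verts G"
    and dst_in_verts: "j \<in> {1, 2, 3} \<Longrightarrow> dst j \<in> verts G"
    and src_neq_dst: "i \<in> {1, 2, 3} \<Longrightarrow> j \<in> {1, 2, 3} \<Longrightarrow> src i \<noteq> dst j"
    and delay_pos: "e \<in> arcs G \<Longrightarrow> delay e > 0"
begin

text \<open>Every link carries one symbol per use, so the capacity of a cut is its number of links.\<close>

definition min_cut :: "'v \<Rightarrow> 'v \<Rightarrow> nat" where
  "min_cut u v =
    (INF X \<in> {X. X \<subseteq> verts G \<and> u \<in> X \<and> v \<notin> X}.
      card {e \<in> arcs G. tail G e \<in> X \<and> head G e \<notin> X})"

text \<open>
  In the following, \<open>x\<close> assigns to every local encoding kernel an element of the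
  coefficient field. Distinct indeterminates will be used as values.
\<close>

definition path_gain :: "('e lek \<Rightarrow> 'k::field) \<Rightarrow> nat \<Rightarrow> nat \<Rightarrow> 'e list \<Rightarrow> 'k" where
  "path_gain x i j P =
    x (Alpha i (hd P)) * (\<Prod>s<length P - 1. x (Beta (P ! s) (P ! Suc s))) * x (Eps (last P) j)"

definition path_delay :: "'e list \<Rightarrow> nat" where
  "path_delay P = (\<Sum>e\<leftarrow>P. delay e)"

text \<open>The polynomial variable is the delay operator $D$.\<close>

definition transfer :: "('e lek \<Rightarrow> 'k::field) \<Rightarrow> nat \<Rightarrow> nat \<Rightarrow> 'k poly" where
  "transfer x i j =
    (\<Sum>P | apath (src i) P (dst j). monom (path_gain x i j P) (path_delay P))"

definition eta0 :: "('e lek, 'f::field) ratfun" where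
  "eta0 = (let M = (\<lambda>i j. poly (transfer rf_var i j) 1) in
    (M 2 1 * M 3 2 * M 1 3) / (M 3 1 * M 2 3 * M 1 2))"

section \<open>The alignment scheme\<close>

text \<open>
  The scheme uses $2n+1$ blocks, numbered from 0; the kernel \<open>v\<close> in block \<open>l\<close> is the
  indeterminate \<open>(l, v)\<close>. The parameters \<open>a\<close> and \<open>p\<close> give the point \<open>a ^ p\<close> at which
  the transfer functions are evaluated.
\<close>

definition M_mat :: "'f::field \<Rightarrow> nat \<Rightarrow> nat \<Rightarrow> nat \<Rightarrow> nat \<Rightarrow> (nat \<times> 'e lek, 'f) ratfun mat" where
  "M_mat a n p i j = mat_diag (2 * n + 1)
    (\<lambda>l. poly (transfer (\<lambda>v. rf_var (l, v)) i j) (rf_const (a ^ p)))"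

text \<open>\<open>mat_inverse\<close> returns \<open>None\<close> for singular matrices; \<open>M_inv a n p i j\<close> is only used
  for $i \neq j$, where non-zero min-cuts make the matrix invertible (for \<open>a \<noteq> 0\<close>).\<close>

definition M_inv :: "'f::field \<Rightarrow> nat \<Rightarrow> nat \<Rightarrow> nat \<Rightarrow> nat \<Rightarrow> (nat \<times> 'e lek, 'f) ratfun mat" where
  "M_inv a n p i j = the (mat_inverse (M_mat a n p i j))"

definition W_vec :: "nat \<Rightarrow> (nat \<times> 'e lek, 'f::field) ratfun vec" where
  "W_vec n = vec (2 * n + 1) (\<lambda>_. 1)"

definition U_mat :: "'f::field \<Rightarrow> nat \<Rightarrow> nat \<Rightarrow> (nat \<times> 'e lek, 'f) ratfun mat" where
  "U_mat a n p = M_inv a n p 1 2 * M_mat a n p 3 2 * M_inv a n p 3 1 * M_mat a n p 2 1 *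
    M_inv a n p 2 3 * M_mat a n p 1 3"

definition R_mat :: "'f::field \<Rightarrow> nat \<Rightarrow> nat \<Rightarrow> (nat \<times> 'e lek, 'f) ratfun mat" where
  "R_mat a n p = M_mat a n p 1 3 * M_inv a n p 2 3"

definition S_mat :: "'f::field \<Rightarrow> nat \<Rightarrow> nat \<Rightarrow> (nat \<times> 'e lek, 'f) ratfun mat" where
  "S_mat a n p = M_mat a n p 1 2 * M_inv a n p 3 2"

definition V1 :: "'f::field \<Rightarrow> nat \<Rightarrow> nat \<Rightarrow> (nat \<times> 'e lek, 'f) ratfun mat" where
  "V1 a n p = mat_of_cols (2 * n + 1)
    (map (\<lambda>c. (U_mat a n p ^\<^sub>m c) *\<^sub>v W_vec n) [0..<n + 1])"

definition V2 :: "'f::field \<Rightarrow> nat \<Rightarrow> nat \<Rightarrow> (nat \<times> 'e lek, 'f) ratfun mat" where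
  "V2 a n p = mat_of_cols (2 * n + 1)
    (map (\<lambda>c. (R_mat a n p * U_mat a n p ^\<^sub>m c) *\<^sub>v W_vec n) [0..<n])"

definition V3 :: "'f::field \<Rightarrow> nat \<Rightarrow> nat \<Rightarrow> (nat \<times> 'e lek, 'f) ratfun mat" where
  "V3 a n p = mat_of_cols (2 * n + 1)
    (map (\<lambda>c. (S_mat a n p * U_mat a n p ^\<^sub>m c) *\<^sub>v W_vec n) [1..<n + 1])"

text \<open>Rank of the block matrix $[A\ B]$, whose blocks have $2n+1$ rows.\<close>

definition rank2 ::
  "nat \<Rightarrow> (nat \<times> 'e lek, 'f::field) ratfun mat \<Rightarrow> (nat \<times> 'e lek, 'f) ratfun mat \<Rightarrow> nat" where
  "rank2 n A B = vec_space.rank (2 * n + 1) (mat_of_cols (2 * n + 1) (cols A @ cols B))"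

text \<open>The condition at destination \<open>j \<in> {1, 2, 3}\<close>.\<close>

definition rank_condition :: "'f::field \<Rightarrow> nat \<Rightarrow> nat \<Rightarrow> nat \<Rightarrow> bool" where
  "rank_condition a n p j \<longleftrightarrow>
    (if j = 1 then rank2 n (M_mat a n p 1 1 * V1 a n p) (M_mat a n p 2 1 * V2 a n p) = 2 * n + 1
     else if j = 2 then rank2 n (M_mat a n p 2 2 * V2 a n p) (M_mat a n p 1 2 * V1 a n p) = 2 * n + 1
     else rank2 n (M_mat a n p 3 3 * V3 a n p) (M_mat a n p 1 3 * V1 a n p) = 2 * n + 1)"

text \<open>
  Destination \<open>i\<close> can recover its message from the received component \<open>p\<close> if the useful and
  the aligned interfering columns together have full rank, for every size \<open>n > 1\<close> of the scheme.
\<close>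

definition recoverable :: "'f::field \<Rightarrow> nat \<Rightarrow> nat \<Rightarrow> bool" where
  "recoverable a p i \<longleftrightarrow> (\<forall>n>1. rank_condition a n p i)"

end

end

theory Submission
  imports Defs
begin

text \<open>
  The transfer functions at \<open>\<alpha> ^ p\<close> arise from those at 1 by a change of variables:
  multiplying every $\alpha_{i,e}$ and $\beta_{e',e}$ by $(\alpha^p)^{d_e}$ multiplies each path gain
  by $(\alpha^p)^{d_P}$. As \<open>\<alpha> \<noteq> 0\<close>, this is an injective endomorphism of the field of rational
  functions. It carries all matrices of the scheme for the component 0 to those for \<open>p\<close>, and
  a field homomorphism preserves ranks.
\<close>

section \<open>Monomial substitutions in rational functions\<close>

lemma poly_mapping_sum_single:
  "(\<Sum>k\<in>Poly_Mapping.keys p. Poly_Mapping.single k (Poly_Mapping.lookup p k)) = p"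
  by (rule poly_mapping_eqI)
    (simp add: lookup_sum lookup_single when_def in_keys_iff)

text \<open>Used at two levels: on exponent vectors (weight 1) to rename indeterminates, and on
  polynomials to rename monomials and scale their coefficients.\<close>

definition reindex :: "('a \<Rightarrow> 'b) \<Rightarrow> ('a \<Rightarrow> 'c) \<Rightarrow> ('a \<Rightarrow>\<^sub>0 'c) \<Rightarrow> ('b \<Rightarrow>\<^sub>0 'c::comm_semiring_1)" where
  "reindex g w p = (\<Sum>k\<in>Poly_Mapping.keys p. Poly_Mapping.single (g k) (w k * Poly_Mapping.lookup p k))"

lemma reindex_superset:
  assumes "finite A" "Poly_Mapping.keys p \<subseteq> A"
  shows "reindex g w p = (\<Sum>k\<in>A. Poly_Mapping.single (g k) (w k * Poly_Mapping.lookup p k))"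
  unfolding reindex_def using assms by (intro sum.mono_neutral_left) (auto simp: in_keys_iff)

lemma reindex_add: "reindex g w (p + q) = reindex g w p + reindex g w q"
proof -
  have "Poly_Mapping.keys (p + q) \<subseteq> Poly_Mapping.keys p \<union> Poly_Mapping.keys q"
    by (rule keys_add)
  then show ?thesis
    by (simp add: reindex_superset[where A = "Poly_Mapping.keys p \<union> Poly_Mapping.keys q"] lookup_add distrib_left single_add
        sum.distrib)
qed

lemma reindex_zero [simp]: "reindex g w 0 = 0"
  by (simp add: reindex_def)

lemma reindex_sum: "reindex g w (sum f A) = (\<Sum>x\<in>A. reindex g w (f x))"
  by (induction A rule: infinite_finite_induct) (simp_all add: reindex_add)

lemma reindex_single [simp]:
  "reindex g w (Poly_Mapping.single k c) = Poly_Mapping.single (g k) (w k * c)"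
  by (simp add: reindex_def)

text \<open>By bilinearity it suffices to compare products of single terms, where additivity of
  \<open>g\<close> handles the exponents and multiplicativity of \<open>w\<close> the
  coefficients.\<close>

lemma reindex_mult:
  assumes "\<And>k l. g (k + l) = g k + g l" and "\<And>k l. w (k + l) = w k * w l"
  shows "reindex g w (p * q) = reindex g w p * reindex g w q"
proof -
  have "p * q = (\<Sum>k\<in>Poly_Mapping.keys p. Poly_Mapping.single k (Poly_Mapping.lookup p k)) *
      (\<Sum>l\<in>Poly_Mapping.keys q. Poly_Mapping.single l (Poly_Mapping.lookup q l))"
    by (simp only: poly_mapping_sum_single)
  then show ?thesis
    by (simp add: sum_product mult_single reindex_sum assms)
      (simp add: reindex_def sum_product mult_single ac_simps)
qed

text \<open>Injectivity of \<open>g\<close> keeps distinct terms apart, so only the term at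
  \<open>k\<close> lands on \<open>g k\<close>.\<close>

lemma lookup_reindex:
  assumes "inj g"
  shows "Poly_Mapping.lookup (reindex g w p) (g k) = w k * Poly_Mapping.lookup p k"
  using assms
  by (simp add: reindex_def lookup_sum lookup_single when_def inj_eq in_keys_iff)

lemma inj_reindex:
  fixes w :: "'a \<Rightarrow> 'c::idom"
  assumes "inj g" "\<And>k. w k \<noteq> 0"
  shows "inj (reindex g w)"
proof (rule injI)
  fix p q assume "reindex g w p = reindex g w q"
  then have "w k * Poly_Mapping.lookup p k = w k * Poly_Mapping.lookup q k" for k
    using lookup_reindex[OF assms(1)] by metis
  then show "p = q"
    using assms(2) by (intro poly_mapping_eqI) simp
qed

text \<open>The value of the monomial \<open>m\<close> at the point \<open>c\<close>, i.e. the
  factor \<open>m\<close> picks up when each indeterminate \<open>v\<close> is replaced by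
  \<open>c v\<close> times itself.\<close>

definition monomial_weight :: "('x \<Rightarrow> 'f) \<Rightarrow> ('x indet \<Rightarrow>\<^sub>0 nat) \<Rightarrow> 'f::comm_semiring_1" where
  "monomial_weight c m = (\<Prod>v\<in>Poly_Mapping.keys m. c (case v of Indet x \<Rightarrow> x) ^ Poly_Mapping.lookup m v)"

lemma monomial_weight_add:
  "monomial_weight c (m + m') = monomial_weight c m * monomial_weight c m'"
proof -
  have *: "monomial_weight c k = (\<Prod>v\<in>Poly_Mapping.keys m \<union> Poly_Mapping.keys m'. c (case v of Indet x \<Rightarrow> x) ^ Poly_Mapping.lookup k v)"
    if "Poly_Mapping.keys k \<subseteq> Poly_Mapping.keys m \<union> Poly_Mapping.keys m'" for k
    unfolding monomial_weight_def using that
    by (intro prod.mono_neutral_left) (auto simp: in_keys_iff)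
  show ?thesis
    using keys_add[of m m'] by (simp add: * lookup_add power_add prod.distrib)
qed

lemma monomial_weight_single [simp]:
  "monomial_weight c (Poly_Mapping.single (Indet v) k) = c v ^ k"
  by (simp add: monomial_weight_def)

lemma monomial_weight_zero [simp]: "monomial_weight c 0 = 1"
  by (simp add: monomial_weight_def)

text \<open>This is the substitution of \<open>c v\<close> times the indeterminate
  \<open>g v\<close> for each indeterminate \<open>v\<close>.\<close>

definition subst_poly :: "('x \<Rightarrow> 'y) \<Rightarrow> ('x \<Rightarrow> 'f) \<Rightarrow>
    (('x indet \<Rightarrow>\<^sub>0 nat) \<Rightarrow>\<^sub>0 'f) \<Rightarrow> (('y indet \<Rightarrow>\<^sub>0 nat) \<Rightarrow>\<^sub>0 'f::field)" where
  "subst_poly g c = reindex (reindex (map_indet g) (\<lambda>_. 1)) (monomial_weight c)"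

text \<open>An injective renaming keeps distinct monomials distinct, and nonzero weights cancel no
  coefficient. Injectivity is what allows the extension to fractions.\<close>

lemma inj_idom_hom_subst_poly:
  fixes c :: "'x \<Rightarrow> 'f::field"
  assumes "inj g" "\<And>v. c v \<noteq> 0"
  shows "inj_idom_hom (subst_poly g c)"
proof -
  let ?r = "reindex (map_indet g) (\<lambda>_. 1) :: _ \<Rightarrow> (_ \<Rightarrow>\<^sub>0 nat)"
  have "inj ?r"
  proof (rule injI, rule poly_mapping_eqI)
    fix m m' :: "'x indet \<Rightarrow>\<^sub>0 nat" and v
    assume "?r m = ?r m'"
    moreover have "inj (map_indet g)"
      using assms(1) by (rule indet.inj_map)
    ultimately show "Poly_Mapping.lookup m v = Poly_Mapping.lookup m' v"
      by (metis lookup_reindex mult_1)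
  qed
  moreover have "monomial_weight c m \<noteq> 0" for m
    using assms(2) by (simp add: monomial_weight_def)
  ultimately have "inj (subst_poly g c)"
    unfolding subst_poly_def by (intro inj_reindex) auto
  then show ?thesis
    by unfold_locales
      (auto simp: subst_poly_def reindex_add reindex_mult monomial_weight_add
        simp flip: single_one dest: injD[where y = 0])
qed

definition map_fract :: "('a::idom \<Rightarrow> 'b::idom) \<Rightarrow> 'a fract \<Rightarrow> 'b fract" where
  "map_fract h q = (SOME r. \<exists>a b. b \<noteq> 0 \<and> q = Fract a b \<and> r = Fract (h a) (h b))"

context inj_idom_hom
begin

text \<open>The representative chosen in \<open>map_fract\<close> may differ from \<open>a\<close>
  over \<open>b\<close>, but \<open>hom\<close> preserves the cross-multiplied equation, and
  injectivity keeps denominators nonzero.\<close>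

lemma map_fract_Fract:
  assumes "b \<noteq> 0"
  shows "map_fract hom (Fract a b) = Fract (hom a) (hom b)"
proof -
  have "\<exists>r a' b'. b' \<noteq> 0 \<and> Fract a b = Fract a' b' \<and> r = Fract (hom a') (hom b')"
    using assms by blast
  from someI_ex[OF this] obtain a' b'
    where *: "b' \<noteq> 0" "Fract a b = Fract a' b'" "map_fract hom (Fract a b) = Fract (hom a') (hom b')"
    unfolding map_fract_def by blast
  then have "hom (a * b') = hom (a' * b)"
    using assms by (simp add: eq_fract)
  then show ?thesis
    using * assms by (simp add: eq_fract hom_mult)
qed

lemma field_hom_map_fract: "field_hom (map_fract hom)"
proof
  fix p q
  show "map_fract hom (p + q) = map_fract hom p + map_fract hom q"
    by (cases p; cases q) (simp add: map_fract_Fract hom_distribs)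
  show "map_fract hom (p * q) = map_fract hom p * map_fract hom q"
    by (cases p; cases q) (simp add: map_fract_Fract hom_distribs)
qed (simp_all add: Zero_fract_def One_fract_def map_fract_Fract)

end

text \<open>Applied below with \<open>g = id\<close>, to rescale the kernels of all blocks, and with
  \<open>g = Pair l\<close>, to embed the single-copy kernels into block \<open>l\<close>.\<close>

lemma exists_field_hom:
  fixes c :: "'x \<Rightarrow> 'f::field" and g :: "'x \<Rightarrow> 'y"
  assumes "inj g" "\<And>v. c v \<noteq> 0"
  obtains h :: "('x, 'f) ratfun \<Rightarrow> ('y, 'f) ratfun" where
    "field_hom h" "\<And>a. h (rf_const a) = rf_const a"
    "\<And>v. h (rf_var v) = rf_const (c v) * rf_var (g v)"
proof
  interpret inj_idom_hom "subst_poly g c"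
    using assms by (rule inj_idom_hom_subst_poly)
  show "field_hom (map_fract (subst_poly g c))"
    by (rule field_hom_map_fract)
  show "map_fract (subst_poly g c) (rf_const a) = rf_const a" for a
    by (simp add: rf_const_def map_fract_Fract) (simp add: subst_poly_def)
  show "map_fract (subst_poly g c) (rf_var v) = rf_const (c v) * rf_var (g v)" for v
    by (simp add: rf_const_def rf_var_def map_fract_Fract)
      (simp add: subst_poly_def mult_single)
qed

lemma rf_const_mult: "rf_const (a * b) = rf_const a * rf_const b"
  by (simp add: rf_const_def mult_single)

lemma rf_const_one [simp]: "rf_const 1 = 1"
  by (simp add: rf_const_def One_fract_def)

lemma rf_const_zero [simp]: "rf_const 0 = 0"
  by (simp add: rf_const_def Zero_fract_def)

lemma rf_const_power: "rf_const (a ^ k) = rf_const a ^ k"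
  by (induction k) (simp_all add: rf_const_mult)

section \<open>Diagonal matrices and entrywise maps\<close>

text \<open>The explicit inverse \<open>?C\<close> rules out the result \<open>None\<close>;
  uniqueness of inverses then identifies the result.\<close>

lemma mat_inverse_mat_diag:
  fixes f :: "nat \<Rightarrow> 'a::field"
  assumes "\<And>l. f l \<noteq> 0"
  shows "mat_inverse (mat_diag n f) = Some (mat_diag n (\<lambda>l. inverse (f l)))"
proof -
  let ?C = "mat_diag n (\<lambda>l. inverse (f l))"
  have C: "mat_diag n f * ?C = 1\<^sub>m n" "?C * mat_diag n f = 1\<^sub>m n"
    using assms by simp_all
  then have "mat_diag n f \<in> Units (ring_mat TYPE('a) n ())"
    unfolding Units_def ring_mat_def by (auto intro!: bexI[of _ ?C])
  then obtain B where B: "mat_inverse (mat_diag n f) = Some B"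
    using mat_inverse(1)[OF mat_diag_dim[of n f], where b = "()"] by (cases "mat_inverse (mat_diag n f)") auto
  have "B * mat_diag n f = 1\<^sub>m n" "B \<in> carrier_mat n n"
    using mat_inverse(2)[OF mat_diag_dim B] by auto
  then have "B = ?C"
    using C(1) assoc_mult_mat[of B n n "mat_diag n f" n ?C n] left_mult_one_mat[of ?C n n]
    by (simp del: mat_diag_diag left_mult_one_mat')
  then show ?thesis
    using B by simp
qed

lemma map_mat_mat_of_cols:
  assumes "set vs \<subseteq> carrier_vec n"
  shows "map_mat h (mat_of_cols n vs) = mat_of_cols n (map (map_vec h) vs)"
proof (rule eq_matI)
  fix i j
  assume "i < dim_row (mat_of_cols n (map (map_vec h) vs))" "j < dim_col (mat_of_cols n (map (map_vec h) vs))"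
  moreover from this have "vs ! j \<in> carrier_vec n"
    using assms by auto
  ultimately show "map_mat h (mat_of_cols n vs) $$ (i, j) = mat_of_cols n (map (map_vec h) vs) $$ (i, j)"
    by (simp add: mat_of_cols_index)
qed auto

lemma map_mat_mat_diag: "h 0 = 0 \<Longrightarrow> map_mat h (mat_diag n f) = mat_diag n (\<lambda>l. h (f l))"
  by (auto simp: mat_diag_def)

lemma cols_map_mat: "cols (map_mat h A) = map (map_vec h) (cols A)"
  by (auto simp: cols_def)

section \<open>Rescaling the kernels moves the evaluation point\<close>

context delay_network
begin

lemma path_gain_rescale:
  fixes h :: "'k::field \<Rightarrow> 'l::field"
  assumes "field_hom h"
    and alpha: "\<And>i e. h (x (Alpha i e)) = s ^ delay e * y (Alpha i e)"
    and beta: "\<And>e' e. h (x (Beta e' e)) = s ^ delay e * y (Beta e' e)"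
    and eps: "\<And>e j. h (x (Eps e j)) = y (Eps e j)"
    and "P \<noteq> []"
  shows "h (path_gain x i j P) = path_gain y i j P * s ^ path_delay P"
proof -
  interpret field_hom h by fact
  obtain e es where P: "P = e # es"
    using \<open>P \<noteq> []\<close> by (cases P) auto
  \<comment> \<open>The \<open>Beta\<close> factor with index \<open>t\<close> feeds link
    \<open>Suc t\<close> of \<open>P\<close>, which is \<open>es ! t\<close>. The head
    \<open>e\<close> is accounted for by \<open>Alpha\<close>.\<close>
  have "(\<Prod>t<length es. s ^ delay (es ! t)) = s ^ (\<Sum>e\<leftarrow>es. delay e)"
    by (simp add: power_sum sum_list_sum_nth atLeast0LessThan)
  then show ?thesis
    unfolding path_gain_def path_delay_def P
    by (simp add: hom_distribs alpha beta eps prod.distrib power_add)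
qed

lemma transfer_rescale:
  fixes h :: "'k::field \<Rightarrow> 'l::field"
  assumes "field_hom h"
    and "\<And>i e. h (x (Alpha i e)) = s ^ delay e * y (Alpha i e)"
    and "\<And>e' e. h (x (Beta e' e)) = s ^ delay e * y (Beta e' e)"
    and "\<And>e j. h (x (Eps e j)) = y (Eps e j)"
    and "i \<in> {1, 2, 3}" "j \<in> {1, 2, 3}"
  shows "h (poly (transfer x i j) 1) = poly (transfer y i j) s"
proof -
  interpret field_hom h by fact
  \<comment> \<open>An empty path would force source and destination to coincide;
    \<open>path_gain\<close> needs a first and a last link.\<close>
  have "P \<noteq> []" if "apath (src i) P (dst j)" for P
    using that src_neq_dst[OF assms(5,6)] by (auto simp: apath_Nil_iff)
  then show ?thesis
    unfolding transfer_def
    by (simp add: poly_sum poly_monom hom_distribs path_gain_rescale[OF assms(1-4)])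
qed

text \<open>Each link of a path is charged to the kernel that feeds it, \<open>Alpha\<close> for the first link
  and \<open>Beta\<close> for the others, so that its delay is counted exactly once.\<close>

fun fed_delay :: "'e lek \<Rightarrow> nat" where
  "fed_delay (Alpha i e) = delay e"
| "fed_delay (Beta e' e) = delay e"
| "fed_delay (Eps e j) = 0"

definition entry :: "'f::field \<Rightarrow> nat \<Rightarrow> nat \<Rightarrow> nat \<Rightarrow> nat \<Rightarrow> (nat \<times> 'e lek, 'f) ratfun" where
  "entry a p i j l = poly (transfer (\<lambda>v. rf_var (l, v)) i j) (rf_const (a ^ p))"

lemma M_mat_entry: "M_mat a n p i j = mat_diag (2 * n + 1) (entry a p i j)"
  by (simp add: M_mat_def entry_def[abs_def])

text \<open>Component 0 evaluates at 1. The substitution keeps the block index and scales each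
  kernel by \<open>a ^ p\<close> per unit of fed delay, so one \<open>h\<close> serves all pairs and
  all blocks, as needed for products of the matrices.\<close>

lemma entry_rescale:
  fixes a :: "'f::field"
  assumes "a \<noteq> 0"
  obtains h :: "(nat \<times> 'e lek, 'f) ratfun \<Rightarrow> (nat \<times> 'e lek, 'f) ratfun" where "field_hom h"
    "\<And>i j l. i \<in> {1, 2, 3} \<Longrightarrow> j \<in> {1, 2, 3} \<Longrightarrow> h (entry a 0 i j l) = entry a p i j l"
proof -
  obtain h :: "(nat \<times> 'e lek, 'f) ratfun \<Rightarrow> (nat \<times> 'e lek, 'f) ratfun" where h: "field_hom h"
    and "\<And>v. h (rf_var v) = rf_const ((a ^ p) ^ fed_delay (snd v)) * rf_var (id v)"
    using exists_field_hom[of id "\<lambda>v. (a ^ p) ^ fed_delay (snd v)"] assms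
    by (metis inj_on_id power_not_zero)
  then show thesis
    using that[OF h] unfolding entry_def
    by (simp add: rf_const_power transfer_rescale[OF h])
qed

text \<open>An embedding of the single-copy field carries the transfer function at 1 to the entry,
  and field homomorphisms are injective. This passes nonvanishing from the factors of
  \<open>eta0\<close> to every block and component.\<close>

lemma entry_eq_0_iff:
  fixes a :: "'f::field"
  assumes "a \<noteq> 0" "i \<in> {1, 2, 3}" "j \<in> {1, 2, 3}"
  shows "entry a p i j l = 0 \<longleftrightarrow> poly (transfer (rf_var :: _ \<Rightarrow> ('e lek, 'f) ratfun) i j) 1 = 0"
proof -
  obtain h :: "('e lek, 'f) ratfun \<Rightarrow> (nat \<times> 'e lek, 'f) ratfun" where h: "field_hom h"
    and var: "\<And>v. h (rf_var v) = rf_const ((a ^ p) ^ fed_delay v) * rf_var (l, v)"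
    using exists_field_hom[of "Pair l" "\<lambda>v. (a ^ p) ^ fed_delay v"] assms
    by (metis inj_on_def prod.inject power_not_zero)
  interpret field_hom h by fact
  have "h (poly (transfer rf_var i j) 1) = entry a p i j l"
    unfolding entry_def using assms(2,3)
    by (intro transfer_rescale[OF h]) (simp_all add: var rf_const_power)
  then show ?thesis
    by (metis hom_0_iff)
qed

text \<open>Since \<open>r + s = 2 * n + 1\<close>, the block matrix is square, so full rank means
  nonzero determinant, and \<open>h\<close> commutes with determinants and is injective.\<close>

lemma rank2_map_mat:
  assumes "field_hom h"
    and A: "A \<in> carrier_mat (2 * n + 1) r" and B: "B \<in> carrier_mat (2 * n + 1) s"
    and "r + s = 2 * n + 1"
  shows "rank2 n (map_mat h A) (map_mat h B) = 2 * n + 1 \<longleftrightarrow> rank2 n A B = 2 * n + 1"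
proof -
  interpret field_hom h by fact
  let ?N = "2 * n + 1"
  let ?C = "mat_of_cols ?N (cols A @ cols B)"
  have "set (cols A @ cols B) \<subseteq> carrier_vec ?N"
    using A B cols_dim[of A] cols_dim[of B] by auto
  then have map: "mat_of_cols ?N (cols (map_mat h A) @ cols (map_mat h B)) = map_mat h ?C"
    by (simp add: map_mat_mat_of_cols cols_map_mat)
  have C: "?C \<in> carrier_mat ?N ?N"
    using A B assms(4) by (auto simp: mat_of_cols_def)
  then have "map_mat h ?C \<in> carrier_mat ?N ?N"
    by simp
  from vec_space.det_rank_iff[OF this] vec_space.det_rank_iff[OF C] show ?thesis
    unfolding rank2_def map by simp
qed

text \<open>That \<open>eta0\<close> is nonzero guarantees genuine inverses: for a singular matrix
  \<open>M_inv\<close> would be \<open>the None\<close>, about which \<open>h\<close> says nothing.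
  The pair (3, 2), inverted in \<open>S_mat\<close>, is a numerator factor of
  \<open>eta0\<close>.\<close>

lemma rank_condition_rescale:
  fixes a :: "'f::field"
  assumes "a \<noteq> 0" and eta0: "(eta0 :: ('e lek, 'f) ratfun) \<noteq> 0"
  shows "rank_condition a n p t \<longleftrightarrow> rank_condition a n 0 t"
proof -
  let ?N = "2 * n + 1"
  obtain h :: "(nat \<times> 'e lek, 'f) ratfun \<Rightarrow> (nat \<times> 'e lek, 'f) ratfun" where h: "field_hom h"
    and entry: "\<And>i j l. i \<in> {1, 2, 3} \<Longrightarrow> j \<in> {1, 2, 3} \<Longrightarrow> h (entry a 0 i j l) = entry a p i j l"
    using entry_rescale[OF \<open>a \<noteq> 0\<close>] by blast
  interpret field_hom h by fact
  have M: "M_mat a n p i j = map_mat h (M_mat a n 0 i j)" if "i \<in> {1, 2, 3}" "j \<in> {1, 2, 3}" for i j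
    using that by (simp add: M_mat_entry map_mat_mat_diag entry)
  have carr_M: "M_mat a n q i j \<in> carrier_mat ?N ?N" for q i j
    by (simp add: M_mat_def)
  \<comment> \<open>Since \<open>x / 0 = 0\<close>, \<open>eta0 \<noteq> 0\<close> makes the denominators nonzero as well.\<close>
  have inv: "M_inv a n q i j = mat_diag ?N (\<lambda>l. inverse (entry a q i j l))"
    if "(i, j) \<in> {(1, 2), (3, 1), (2, 3), (3, 2)}" for q i j
  proof -
    have "entry a q i j l \<noteq> 0" for l
      using that eta0 \<open>a \<noteq> 0\<close> by (auto simp: entry_eq_0_iff eta0_def Let_def)
    then show ?thesis
      by (simp add: M_inv_def M_mat_entry mat_inverse_mat_diag)
  qed
  have M_inv: "M_inv a n p i j = map_mat h (M_inv a n 0 i j)"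
    if "(i, j) \<in> {(1, 2), (3, 1), (2, 3), (3, 2)}" for i j
    unfolding inv[OF that] using that by (auto simp: map_mat_mat_diag hom_inverse entry)
  have carr_M_inv: "M_inv a n q i j \<in> carrier_mat ?N ?N"
    if "(i, j) \<in> {(1, 2), (3, 1), (2, 3), (3, 2)}" for q i j
    unfolding inv[OF that] by simp
  note carr = carr_M carr_M_inv mult_carrier_mat[of _ ?N ?N _ ?N]
  have carr_URS: "U_mat a n q \<in> carrier_mat ?N ?N" "R_mat a n q \<in> carrier_mat ?N ?N"
    "S_mat a n q \<in> carrier_mat ?N ?N" for q
    unfolding U_mat_def R_mat_def S_mat_def by (intro carr; simp)+
  have URS: "U_mat a n p = map_mat h (U_mat a n 0)" "R_mat a n p = map_mat h (R_mat a n 0)"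
    "S_mat a n p = map_mat h (S_mat a n 0)"
    unfolding U_mat_def R_mat_def S_mat_def by (simp_all add: M M_inv mat_hom_mult[of _ ?N ?N _ ?N] carr del: One_nat_def)
  have W: "W_vec n \<in> carrier_vec ?N" "map_vec h (W_vec n) = W_vec n"
    by (auto simp: W_vec_def)
  have pow: "U_mat a n 0 ^\<^sub>m c \<in> carrier_mat ?N ?N" for c
    using carr_URS(1) by (rule pow_carrier_mat)
  \<comment> \<open>The all-ones vector is fixed by \<open>h\<close>, so applying \<open>h\<close>
    to a column only changes the matrix in front of it.\<close>
  have cols: "map_mat h (mat_of_cols ?N (map (\<lambda>c. A c *\<^sub>v W_vec n) cs)) =
      mat_of_cols ?N (map (\<lambda>c. map_mat h (A c) *\<^sub>v W_vec n) cs)"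
    if "\<And>c. A c \<in> carrier_mat ?N ?N" for A cs
  proof -
    have "A c *\<^sub>v W_vec n \<in> carrier_vec ?N" for c
      using that W(1) by (rule mult_mat_vec_carrier)
    then have "map_mat h (mat_of_cols ?N (map (\<lambda>c. A c *\<^sub>v W_vec n) cs)) =
        mat_of_cols ?N (map (map_vec h) (map (\<lambda>c. A c *\<^sub>v W_vec n) cs))"
      by (intro map_mat_mat_of_cols) auto
    then show ?thesis
      by (simp add: comp_def mult_mat_vec_hom[OF that W(1)] W(2))
  qed
  have V: "V1 a n p = map_mat h (V1 a n 0)" "V2 a n p = map_mat h (V2 a n 0)"
    "V3 a n p = map_mat h (V3 a n 0)"
    unfolding V1_def V2_def V3_def URS mat_hom_pow[OF carr_URS(1), symmetric]
      mat_hom_mult[OF carr_URS(2) pow, symmetric] mat_hom_mult[OF carr_URS(3) pow, symmetric]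
    by (intro cols[symmetric] mult_carrier_mat[of _ ?N ?N _ ?N] pow carr_URS)+
  have carr_V: "V1 a n q \<in> carrier_mat ?N (n + 1)" "V2 a n q \<in> carrier_mat ?N n"
    "V3 a n q \<in> carrier_mat ?N n" for q
    by (auto simp: V1_def V2_def V3_def mat_of_cols_def)
  \<comment> \<open>The widths stay general because the block of width \<open>n + 1\<close> comes
    first at destination 1 but second at destinations 2 and 3.\<close>
  have rank: "rank2 n (M_mat a n p i j * map_mat h V) (M_mat a n p i' j * map_mat h V') = ?N \<longleftrightarrow>
      rank2 n (M_mat a n 0 i j * V) (M_mat a n 0 i' j * V') = ?N"
    if "i \<in> {1, 2, 3}" "i' \<in> {1, 2, 3}" "j \<in> {1, 2, 3}" "V \<in> carrier_mat ?N r"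
      "V' \<in> carrier_mat ?N s" "r + s = ?N" for i i' j V V' r s
    unfolding M[OF that(1,3)] M[OF that(2,3)] mat_hom_mult[OF carr_M that(4), symmetric]
      mat_hom_mult[OF carr_M that(5), symmetric]
    using mult_carrier_mat[OF carr_M that(4)] mult_carrier_mat[OF carr_M that(5)] that(6)
    by (rule rank2_map_mat[OF h])
  have "rank2 n (M_mat a n p 1 1 * V1 a n p) (M_mat a n p 2 1 * V2 a n p) = ?N \<longleftrightarrow>
      rank2 n (M_mat a n 0 1 1 * V1 a n 0) (M_mat a n 0 2 1 * V2 a n 0) = ?N"
    "rank2 n (M_mat a n p 2 2 * V2 a n p) (M_mat a n p 1 2 * V1 a n p) = ?N \<longleftrightarrow>
      rank2 n (M_mat a n 0 2 2 * V2 a n 0) (M_mat a n 0 1 2 * V1 a n 0) = ?N"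
    "rank2 n (M_mat a n p 3 3 * V3 a n p) (M_mat a n p 1 3 * V1 a n p) = ?N \<longleftrightarrow>
      rank2 n (M_mat a n 0 3 3 * V3 a n 0) (M_mat a n 0 1 3 * V1 a n 0) = ?N"
    unfolding V by (rule rank[OF _ _ _ carr_V(1) carr_V(2)] rank[OF _ _ _ carr_V(2) carr_V(1)]
      rank[OF _ _ _ carr_V(3) carr_V(1)]; simp)+
  then show ?thesis
    by (simp only: rank_condition_def)
qed

end

theorem theorem3:
  fixes G :: "('v, 'e) pre_digraph"
    and src dst :: "nat \<Rightarrow> 'v"
    and delay :: "'e \<Rightarrow> nat"
    and \<alpha> :: "'f::{field,finite}"
    and m k i :: nat
  assumes "delay_network G src dst delay"
    and "card (UNIV :: 'f set) = 2 ^ m"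
    and "\<And>i. i \<in> {1, 2, 3} \<Longrightarrow> delay_network.min_cut G (src i) (dst i) = 1"
    and "\<And>i j. i \<in> {1, 2, 3} \<Longrightarrow> j \<in> {1, 2, 3} \<Longrightarrow> i \<noteq> j \<Longrightarrow>
           delay_network.min_cut G (src i) (dst j) \<noteq> 0"
    and "k > 1" and "k dvd 2 ^ m - 1"
    and "\<alpha> ^ k = 1" and "\<And>r. 0 < r \<Longrightarrow> r < k \<Longrightarrow> \<alpha> ^ r \<noteq> 1"
    and "(delay_network.eta0 G src dst delay :: ('e lek, 'f) ratfun) \<notin> range rf_const"
    and "i \<in> {1, 2, 3}"
  shows "(\<forall>p\<in>{0..k - 1}. delay_network.recoverable G src dst delay \<alpha> p i) \<longleftrightarrow>
         delay_network.recoverable G src dst delay \<alpha> 0 i"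
proof -
  interpret delay_network G src dst delay by fact
  have "\<alpha> \<noteq> 0"
    using \<open>\<alpha> ^ k = 1\<close> \<open>k > 1\<close> by (auto simp: power_0_left)
  \<comment> \<open>Zero is the constant \<open>rf_const 0\<close>, so a nonconstant
    \<open>eta0\<close> is nonzero.\<close>
  moreover have "(eta0 :: ('e lek, 'f) ratfun) \<noteq> 0"
    using assms(9) rf_const_zero by (metis rangeI)
  \<comment> \<open>The rank conditions agree for each \<open>n\<close> separately, hence also under
    the quantifier over \<open>n\<close>.\<close>
  ultimately have "recoverable \<alpha> p i \<longleftrightarrow> recoverable \<alpha> 0 i" for p
    unfolding recoverable_def using rank_condition_rescale by blast
  then show ?thesis
    by auto
qed

end
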